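(* Let $X$ be a flasque metric space, witnessed by the coarse map $\phi:X\to X$. Then the map $$\varPhi:X\times\mathbb{Z}_{\ge 0}\to X,\qquad (x,i)\mapsto\phi^{\circ i}(x)$$ is a coarse homotopy equivalence. Here $\phi^{\circ 0}$ denotes the identity on $X$.
   Context: Metrics take only finite values; spaces in which a basepoint is chosen are understood to be nonempty. A subset $E\subseteq X\times X$ of the square of a metric space is an entourage if $\sup_{(x,y)\in E}d(x,y)<\infty$. A map $f:X\to Y$ between metric spaces is coarse if $(f\times f)(E)$ is an entourage for every entourage $E$ and $f^{-1}(B)$ is bounded for every bounded $B\subseteq Y$. Maps $f,g:X\to Y$ are close if $\sup_{x} d(f(x),g(x))<\infty$. Products of metric spaces carry the maximum metric. A metric space $X$ is flasque if there is a coarse map $\phi:X\to X$ such that: $\phi$ is close to $\mathrm{id}_X$; for every bounded $B\subseteq X$ there is $N_B\in\mathbb{N}$ with $\phi^{\circ n}(X)\cap B=\emptyset$ for every $n>N_B$; for every entourage $E$ the set $\bigcup_n(\phi^{\circ n}\times\phi^{\circ n})(E)$ is an entourage. Coarse homotopy: let $I=\mathbb{R}_{\ge0}\times\mathbb{R}_{\ge0}$ with the metric $d((s_0,t_0),(s_1,t_1))=|s_0-s_1|+|t_0-t_1|$. For a metric space $X$ with basepoint $x_0$ put $X\ast I=\{(x,(s,t))\in X\times I: d(x,x_0)=s+t\}$ with the metric restricted from the maximum metric on $X\times I$. Let $\iota_0,\iota_1:X\to X\ast I$, $\iota_0(x)=(x,(d(x,x_0),0))$, $\iota_1(x)=(x,(0,d(x,x_0)))$.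 Coarse maps $\alpha,\beta:X\to Y$ are coarsely homotopic if there is a coarse map $h:X\ast I\to Y$ with $h\circ\iota_0$ close to $\alpha$ and $h\circ\iota_1$ close to $\beta$ (this relation does not depend on the choice of $x_0$). A coarse map $\alpha:X\to Y$ is a coarse homotopy equivalence if there is a coarse map $\beta:Y\to X$ such that $\alpha\circ\beta$ is coarsely homotopic to $\mathrm{id}_Y$ and $\beta\circ\alpha$ is coarsely homotopic to $\mathrm{id}_X$. *)

theory Defs
  imports "HOL-Analysis.Analysis"
begin

section \<open>Coarse geometry of metric spaces\<close>

text \<open>
  A metric space is an element of the library type \<open>'a metric\<close>, with carrier \<open>mspace X\<close>
  and distance \<open>mdist X\<close>. Maps between metric spaces are total functions; only their values on
  the carrier matter.
\<close>

abbreviation bounded_in :: "'a metric \<Rightarrow> 'a set \<Rightarrow> bool" where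
  "bounded_in X \<equiv> Metric_space.mbounded (mspace X) (mdist X)"

definition entourage :: "'a metric \<Rightarrow> ('a \<times> 'a) set \<Rightarrow> bool" where
  "entourage X E \<longleftrightarrow>
     E \<subseteq> mspace X \<times> mspace X \<and> bdd_above ((\<lambda>(x, y). mdist X x y) ` E)"

definition coarse_map :: "'a metric \<Rightarrow> 'b metric \<Rightarrow> ('a \<Rightarrow> 'b) \<Rightarrow> bool" where
  "coarse_map X Y f \<longleftrightarrow>
     f \<in> mspace X \<rightarrow> mspace Y \<and>
     (\<forall>E. entourage X E \<longrightarrow> entourage Y (map_prod f f ` E)) \<and>
     (\<forall>B. bounded_in Y B \<longrightarrow> bounded_in X (f -` B \<inter> mspace X))"

definition close_maps :: "'a metric \<Rightarrow> 'b metric \<Rightarrow> ('a \<Rightarrow> 'b) \<Rightarrow> ('a \<Rightarrow> 'b) \<Rightarrow> bool" where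
  "close_maps X Y f g \<longleftrightarrow> bdd_above ((\<lambda>x. mdist Y (f x) (g x)) ` mspace X)"

definition flasque_witness :: "'a metric \<Rightarrow> ('a \<Rightarrow> 'a) \<Rightarrow> bool" where
  "flasque_witness X \<phi> \<longleftrightarrow>
     coarse_map X X \<phi> \<and>
     close_maps X X \<phi> id \<and>
     (\<forall>B. bounded_in X B \<longrightarrow> (\<exists>N. \<forall>n>N. (\<phi> ^^ n) ` mspace X \<inter> B = {})) \<and>
     (\<forall>E. entourage X E \<longrightarrow> entourage X (\<Union>n. map_prod (\<phi> ^^ n) (\<phi> ^^ n) ` E))"

text \<open>
  The library's metric on products is the Euclidean one, so the maximum metric has to be
  introduced here.
\<close>

definition max_prod_metric :: "'a metric \<Rightarrow> 'b metric \<Rightarrow> ('a \<times> 'b) metric" where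
  "max_prod_metric X Y =
     metric (mspace X \<times> mspace Y,
             \<lambda>(x, y) (x', y'). max (mdist X x x') (mdist Y y y'))"

lemma Metric_space_max_prod:
  "Metric_space (mspace X \<times> mspace Y)
     (\<lambda>(x, y) (x', y'). max (mdist X x x') (mdist Y y y'))"
proof -
  interpret X: Metric_space "mspace X" "mdist X" by (rule Metric_space_mspace_mdist)
  interpret Y: Metric_space "mspace Y" "mdist Y" by (rule Metric_space_mspace_mdist)
  show ?thesis
  proof
    fix p q
    assume "p \<in> mspace X \<times> mspace Y" "q \<in> mspace X \<times> mspace Y"
    then show "((case p of (x, y) \<Rightarrow> \<lambda>(x', y'). max (mdist X x x') (mdist Y y y')) q = 0)
        \<longleftrightarrow> p = q"
      by (cases p; cases q)
        (simp, smt (verit) X.nonneg X.zero Y.nonneg Y.zero)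
  next
    fix p q r
    assume "p \<in> mspace X \<times> mspace Y" "q \<in> mspace X \<times> mspace Y" "r \<in> mspace X \<times> mspace Y"
    then show "(case p of (x, y) \<Rightarrow> \<lambda>(x', y'). max (mdist X x x') (mdist Y y y')) r
       \<le> (case p of (x, y) \<Rightarrow> \<lambda>(x', y'). max (mdist X x x') (mdist Y y y')) q +
         (case q of (x, y) \<Rightarrow> \<lambda>(x', y'). max (mdist X x x') (mdist Y y y')) r"
      by (cases p; cases q; cases r)
        (simp, smt (verit) X.triangle Y.triangle)
  qed (auto simp: X.commute Y.commute le_max_iff_disj split: prod.splits)
qed

lemma mspace_max_prod_metric [simp]:
  "mspace (max_prod_metric X Y) = mspace X \<times> mspace Y"
  by (simp add: max_prod_metric_def Metric_space.mspace_metric[OF Metric_space_max_prod])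

lemma mdist_max_prod_metric [simp]:
  "mdist (max_prod_metric X Y) (x, y) (x', y') = max (mdist X x x') (mdist Y y y')"
  by (simp add: max_prod_metric_def Metric_space.mdist_metric[OF Metric_space_max_prod])

definition nat_metric :: "nat metric" where
  "nat_metric = metric (UNIV, \<lambda>i j. \<bar>real i - real j\<bar>)"

lemma Metric_space_nat: "Metric_space UNIV (\<lambda>i j. \<bar>real i - real j\<bar>)"
  by unfold_locales auto

lemma mspace_nat_metric [simp]: "mspace nat_metric = UNIV"
  by (simp add: nat_metric_def Metric_space.mspace_metric[OF Metric_space_nat])

lemma mdist_nat_metric [simp]: "mdist nat_metric i j = \<bar>real i - real j\<bar>"
  by (simp add: nat_metric_def Metric_space.mdist_metric[OF Metric_space_nat])

definition l1_quadrant :: "(real \<times> real) metric" where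
  "l1_quadrant =
     metric ({0..} \<times> {0..}, \<lambda>(s0, t0) (s1, t1). \<bar>s0 - s1\<bar> + \<bar>t0 - t1\<bar>)"

lemma Metric_space_l1_quadrant:
  "Metric_space ({0..} \<times> {0..})
     (\<lambda>(s0, t0) (s1, t1). \<bar>s0 - s1\<bar> + \<bar>t0 - t1 :: real\<bar> :: real)"
  by unfold_locales (auto split: prod.splits)

lemma mspace_l1_quadrant [simp]: "mspace l1_quadrant = {0..} \<times> {0..}"
  by (simp add: l1_quadrant_def Metric_space.mspace_metric[OF Metric_space_l1_quadrant])

lemma mdist_l1_quadrant [simp]:
  "mdist l1_quadrant (s0, t0) (s1, t1) = \<bar>s0 - s1\<bar> + \<bar>t0 - t1\<bar>"
  by (simp add: l1_quadrant_def Metric_space.mdist_metric[OF Metric_space_l1_quadrant])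

definition coarse_cylinder :: "'a metric \<Rightarrow> 'a \<Rightarrow> ('a \<times> real \<times> real) metric" where
  "coarse_cylinder X x0 =
     submetric (max_prod_metric X l1_quadrant) {(x, s, t). mdist X x x0 = s + t}"

definition cyl_incl0 :: "'a metric \<Rightarrow> 'a \<Rightarrow> 'a \<Rightarrow> 'a \<times> real \<times> real" where
  "cyl_incl0 X x0 x = (x, mdist X x x0, 0)"

definition cyl_incl1 :: "'a metric \<Rightarrow> 'a \<Rightarrow> 'a \<Rightarrow> 'a \<times> real \<times> real" where
  "cyl_incl1 X x0 x = (x, 0, mdist X x x0)"

text \<open>
  The relation does not depend on the basepoint; requiring a homotopy for every basepoint, rather
  than for some basepoint, also makes any two maps out of the empty space homotopic.
\<close>

definition coarsely_homotopic :: "'a metric \<Rightarrow> 'b metric \<Rightarrow> ('a \<Rightarrow> 'b) \<Rightarrow> ('a \<Rightarrow> 'b) \<Rightarrow> bool" where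
  "coarsely_homotopic X Y \<alpha> \<beta> \<longleftrightarrow>
     coarse_map X Y \<alpha> \<and> coarse_map X Y \<beta> \<and>
     (\<forall>x0\<in>mspace X. \<exists>h.
        coarse_map (coarse_cylinder X x0) Y h \<and>
        close_maps X Y (h \<circ> cyl_incl0 X x0) \<alpha> \<and>
        close_maps X Y (h \<circ> cyl_incl1 X x0) \<beta>)"

definition coarse_homotopy_equivalence :: "'a metric \<Rightarrow> 'b metric \<Rightarrow> ('a \<Rightarrow> 'b) \<Rightarrow> bool" where
  "coarse_homotopy_equivalence X Y \<alpha> \<longleftrightarrow>
     coarse_map X Y \<alpha> \<and>
     (\<exists>\<beta>. coarse_map Y X \<beta> \<and>
          coarsely_homotopic Y Y (\<alpha> \<circ> \<beta>) id \<and>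
          coarsely_homotopic X X (\<beta> \<circ> \<alpha>) id)"

end

theory Submission
  imports Defs
begin

text \<open>
  Write \<open>\<Phi> (x, i) = \<phi>\<^sup>i x\<close>. The three flasqueness conditions make \<open>\<Phi>\<close> coarse: powers of
  \<open>\<phi>\<close> are uniformly controlled, moving \<open>i\<close> by one moves \<open>\<Phi> (x, i)\<close> by a bounded amount because
  \<open>\<phi>\<close> is close to the identity, and only finitely many powers of \<open>\<phi>\<close> reach a given bounded set,
  so that the preimage of this set is a finite union of bounded slices
  (\<open>coarse_map_iteration\<close>).

  The coarse inverse is the inclusion \<open>\<beta> x = (x, 0)\<close>. Here \<open>\<Phi> \<circ> \<beta>\<close> is equal to the identity,
  whereas \<open>\<beta> \<circ> \<Phi>\<close> sends \<open>(x, i)\<close> to \<open>(\<phi>\<^sup>i x, 0)\<close>. To deform the latter into the identity, apply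
  \<open>\<phi>\<close> only part of the way: with \<open>m = min i \<lfloor>t\<rfloor>\<close>, send \<open>((x, i), (s, t))\<close> to
  \<open>(\<phi>\<^sup>i\<^sup>-\<^sup>m x, m)\<close>. At \<open>t = 0\<close> this is \<open>\<beta> \<circ> \<Phi>\<close>. On the opposite face \<open>t\<close> is the distance of
  \<open>(x, i)\<close> from the basepoint \<open>(x\<^sub>0, i\<^sub>0)\<close>, hence at least \<open>i - i\<^sub>0\<close>, and \<open>i - m \<le> i\<^sub>0\<close> steps of
  \<open>\<phi>\<close> remain, a bounded number.

  This homotopy is coarse because it factors as the splitting \<open>((x, i), (s, t)) \<mapsto> ((x, i - m), m)\<close>
  followed by \<open>\<Phi> \<times> id\<close>. The splitting is controlled, and it is proper since \<open>i\<close> is the sum of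
  its two parts while \<open>s\<close> and \<open>t\<close> are bounded in terms of the distance from the basepoint
  (\<open>coarse_map_split_time\<close>).
\<close>

section \<open>Coarse maps in terms of distances\<close>

lemma mdist_self: "x \<in> mspace X \<Longrightarrow> mdist X x x = 0"
  by simp

lemma bounded_in_subset: "bounded_in X S \<Longrightarrow> T \<subseteq> S \<Longrightarrow> bounded_in X T"
  by (rule Metric_space.mbounded_subset[OF Metric_space_mspace_mdist])

lemma bounded_in_iff:
  "bounded_in X S \<longleftrightarrow> S \<subseteq> mspace X \<and> (\<exists>R. \<forall>x\<in>S. \<forall>y\<in>S. mdist X x y \<le> R)"
  by (rule Metric_space.mbounded_alt[OF Metric_space_mspace_mdist])

lemma entourage_iff:
  "entourage X E \<longleftrightarrow> E \<subseteq> mspace X \<times> mspace X \<and> (\<exists>R. \<forall>(x, y)\<in>E. mdist X x y \<le> R)"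
  by (auto simp: entourage_def bdd_above_def)

lemma coarse_map_iff:
  "coarse_map X Y f \<longleftrightarrow>
     f \<in> mspace X \<rightarrow> mspace Y \<and>
     (\<forall>R. \<exists>S. \<forall>x\<in>mspace X. \<forall>y\<in>mspace X. mdist X x y \<le> R \<longrightarrow> mdist Y (f x) (f y) \<le> S) \<and>
     (\<forall>B. bounded_in Y B \<longrightarrow> bounded_in X (f -` B \<inter> mspace X))"
proof -
  have "(\<forall>E. entourage X E \<longrightarrow> entourage Y (map_prod f f ` E)) \<longleftrightarrow>
     (\<forall>R. \<exists>S. \<forall>x\<in>mspace X. \<forall>y\<in>mspace X. mdist X x y \<le> R \<longrightarrow> mdist Y (f x) (f y) \<le> S)"
    (is "?L \<longleftrightarrow> ?R") if f: "f \<in> mspace X \<rightarrow> mspace Y"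
  proof
    assume L: ?L
    show ?R
    proof
      fix R
      have "entourage X {(x, y) \<in> mspace X \<times> mspace X. mdist X x y \<le> R}"
        by (auto simp: entourage_iff)
      then have "entourage Y (map_prod f f ` {(x, y) \<in> mspace X \<times> mspace X. mdist X x y \<le> R})"
        using L by blast
      then show "\<exists>S. \<forall>x\<in>mspace X. \<forall>y\<in>mspace X. mdist X x y \<le> R \<longrightarrow> mdist Y (f x) (f y) \<le> S"
        unfolding entourage_iff by auto
    qed
  next
    assume R: ?R
    show ?L
    proof (intro allI impI)
      fix E assume "entourage X E"
      then obtain r where E: "E \<subseteq> mspace X \<times> mspace X" "\<forall>(x, y)\<in>E. mdist X x y \<le> r"
        by (auto simp: entourage_iff)
      obtain s where s: "\<forall>x\<in>mspace X. \<forall>y\<in>mspace X. mdist X x y \<le> r \<longrightarrow> mdist Y (f x) (f y) \<le> s"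
        using R by blast
      have "\<forall>(x, y)\<in>map_prod f f ` E. mdist Y x y \<le> s"
        using E s by fastforce
      then show "entourage Y (map_prod f f ` E)"
        using E(1) f unfolding entourage_iff by fastforce
    qed
  qed
  then show ?thesis
    unfolding coarse_map_def by blast
qed

lemma coarse_mapI:
  assumes "\<And>x. x \<in> mspace X \<Longrightarrow> f x \<in> mspace Y"
    and "\<And>R. \<exists>S. \<forall>x\<in>mspace X. \<forall>y\<in>mspace X. mdist X x y \<le> R \<longrightarrow> mdist Y (f x) (f y) \<le> S"
    and "\<And>B. bounded_in Y B \<Longrightarrow> bounded_in X (f -` B \<inter> mspace X)"
  shows "coarse_map X Y f"
  unfolding coarse_map_iff by (intro conjI allI impI funcsetI assms)

lemma coarse_map_in: "coarse_map X Y f \<Longrightarrow> x \<in> mspace X \<Longrightarrow> f x \<in> mspace Y"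
  by (auto simp: coarse_map_def)

lemma coarse_map_controlled:
  assumes "coarse_map X Y f"
  obtains S where
    "\<And>x y. x \<in> mspace X \<Longrightarrow> y \<in> mspace X \<Longrightarrow> mdist X x y \<le> R \<Longrightarrow> mdist Y (f x) (f y) \<le> S"
  using assms unfolding coarse_map_iff by meson

lemma coarse_map_proper:
  "coarse_map X Y f \<Longrightarrow> bounded_in Y B \<Longrightarrow> bounded_in X (f -` B \<inter> mspace X)"
  by (simp add: coarse_map_def)

lemma coarse_map_id: "coarse_map X X id"
  unfolding coarse_map_iff
  by (auto intro: bounded_in_subset)

lemma coarse_map_compose:
  assumes f: "coarse_map X Y f" and g: "coarse_map Y Z g"
  shows "coarse_map X Z (g \<circ> f)"
proof (rule coarse_mapI)
  show "(g \<circ> f) x \<in> mspace Z" if "x \<in> mspace X" for x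
    using coarse_map_in[OF g coarse_map_in[OF f that]] by simp
next
  fix R
  obtain S where S: "\<And>x y. x \<in> mspace X \<Longrightarrow> y \<in> mspace X \<Longrightarrow> mdist X x y \<le> R \<Longrightarrow>
      mdist Y (f x) (f y) \<le> S"
    using coarse_map_controlled[OF f, of R] by blast
  obtain T where T: "\<And>x y. x \<in> mspace Y \<Longrightarrow> y \<in> mspace Y \<Longrightarrow> mdist Y x y \<le> S \<Longrightarrow>
      mdist Z (g x) (g y) \<le> T"
    using coarse_map_controlled[OF g, of S] by blast
  show "\<exists>T. \<forall>x\<in>mspace X. \<forall>y\<in>mspace X. mdist X x y \<le> R \<longrightarrow> mdist Z ((g \<circ> f) x) ((g \<circ> f) y) \<le> T"
    using T[OF coarse_map_in[OF f] coarse_map_in[OF f] S] by auto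
next
  fix B assume "bounded_in Z B"
  then have "bounded_in X (f -` (g -` B \<inter> mspace Y) \<inter> mspace X)"
    by (intro coarse_map_proper[OF f] coarse_map_proper[OF g])
  also have "f -` (g -` B \<inter> mspace Y) \<inter> mspace X = (g \<circ> f) -` B \<inter> mspace X"
    using coarse_map_in[OF f] by auto
  finally show "bounded_in X ((g \<circ> f) -` B \<inter> mspace X)" .
qed

lemma coarse_map_funpow: "coarse_map X X f \<Longrightarrow> coarse_map X X (f ^^ n)"
proof (induction n)
  case 0
  show ?case
    using coarse_map_id[of X] by (simp only: funpow_0 funpow.simps(1))
next
  case (Suc n)
  then show ?case
    unfolding funpow.simps by (intro coarse_map_compose)
qed

lemma bounded_in_max_prod_iff:
  "bounded_in (max_prod_metric X Y) S \<longleftrightarrow>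
     S \<subseteq> mspace X \<times> mspace Y \<and> bounded_in X (fst ` S) \<and> bounded_in Y (snd ` S)"
proof
  assume "bounded_in (max_prod_metric X Y) S"
  then show "S \<subseteq> mspace X \<times> mspace Y \<and> bounded_in X (fst ` S) \<and> bounded_in Y (snd ` S)"
    unfolding bounded_in_iff by fastforce
next
  assume "S \<subseteq> mspace X \<times> mspace Y \<and> bounded_in X (fst ` S) \<and> bounded_in Y (snd ` S)"
  then obtain R R' where S: "S \<subseteq> mspace X \<times> mspace Y"
      and R: "\<forall>p\<in>S. \<forall>q\<in>S. mdist X (fst p) (fst q) \<le> R"
      and R': "\<forall>p\<in>S. \<forall>q\<in>S. mdist Y (snd p) (snd q) \<le> R'"
    unfolding bounded_in_iff by auto
  have "\<forall>p\<in>S. \<forall>q\<in>S. mdist (max_prod_metric X Y) p q \<le> max R R'"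
    using R R' by (fastforce simp: le_max_iff_disj)
  then show "bounded_in (max_prod_metric X Y) S"
    unfolding bounded_in_iff using S by auto
qed

lemma coarse_map_map_prod:
  assumes f: "coarse_map X X' f" and g: "coarse_map Y Y' g"
  shows "coarse_map (max_prod_metric X Y) (max_prod_metric X' Y') (map_prod f g)"
    (is "coarse_map ?P ?P' ?fg")
proof (rule coarse_mapI)
  show "?fg p \<in> mspace ?P'" if "p \<in> mspace ?P" for p
    using that coarse_map_in[OF f] coarse_map_in[OF g] by auto
next
  fix R
  obtain S where S: "\<And>x y. x \<in> mspace X \<Longrightarrow> y \<in> mspace X \<Longrightarrow> mdist X x y \<le> R \<Longrightarrow>
      mdist X' (f x) (f y) \<le> S"
    using coarse_map_controlled[OF f, of R] by blast
  obtain T where T: "\<And>x y. x \<in> mspace Y \<Longrightarrow> y \<in> mspace Y \<Longrightarrow> mdist Y x y \<le> R \<Longrightarrow>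
      mdist Y' (g x) (g y) \<le> T"
    using coarse_map_controlled[OF g, of R] by blast
  have "mdist ?P' (?fg p) (?fg q) \<le> max S T"
    if "p \<in> mspace ?P" "q \<in> mspace ?P" "mdist ?P p q \<le> R" for p q
    using that S[of "fst p" "fst q"] T[of "snd p" "snd q"]
    by (cases p; cases q) (simp add: max.coboundedI1 max.coboundedI2)
  then show "\<exists>S. \<forall>p\<in>mspace ?P. \<forall>q\<in>mspace ?P. mdist ?P p q \<le> R \<longrightarrow> mdist ?P' (?fg p) (?fg q) \<le> S"
    by blast
next
  fix B assume B: "bounded_in ?P' B"
  have "bounded_in X' (fst ` B)" "bounded_in Y' (snd ` B)"
    using B[unfolded bounded_in_max_prod_iff] by simp_all
  note pre = coarse_map_proper[OF f this(1)] coarse_map_proper[OF g this(2)]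
  have "bounded_in X (fst ` (?fg -` B \<inter> mspace ?P))"
    by (rule bounded_in_subset[OF pre(1)]) force
  moreover have "bounded_in Y (snd ` (?fg -` B \<inter> mspace ?P))"
    by (rule bounded_in_subset[OF pre(2)]) force
  moreover have "?fg -` B \<inter> mspace ?P \<subseteq> mspace X \<times> mspace Y"
    by simp
  ultimately show "bounded_in ?P (?fg -` B \<inter> mspace ?P)"
    unfolding bounded_in_max_prod_iff by (intro conjI)
qed

lemma coarse_map_pair_0:
  "coarse_map X (max_prod_metric X nat_metric) (\<lambda>x. (x, 0))"
proof (rule coarse_mapI)
  fix R
  show "\<exists>S. \<forall>x\<in>mspace X. \<forall>y\<in>mspace X. mdist X x y \<le> R \<longrightarrow>
      mdist (max_prod_metric X nat_metric) (x, 0) (y, 0) \<le> S"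
    by (rule exI[of _ "max R 0"]) auto
next
  fix B assume B: "bounded_in (max_prod_metric X nat_metric) B"
  have "bounded_in X (fst ` B)"
    using B[unfolded bounded_in_max_prod_iff] by (elim conjE)
  then show "bounded_in X ((\<lambda>x. (x, 0)) -` B \<inter> mspace X)"
    by (rule bounded_in_subset) force
qed simp_all

section \<open>The coarse cylinder\<close>

lemma mspace_coarse_cylinder:
  "mspace (coarse_cylinder X x0) =
     {(x, s, t). x \<in> mspace X \<and> s \<ge> 0 \<and> t \<ge> 0 \<and> mdist X x x0 = s + t}"
  by (auto simp: coarse_cylinder_def mspace_submetric)

lemma mdist_coarse_cylinder [simp]:
  "mdist (coarse_cylinder X x0) (x, s, t) (x', s', t') =
     max (mdist X x x') (\<bar>s - s'\<bar> + \<bar>t - t'\<bar>)"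
  by (simp add: coarse_cylinder_def mdist_submetric)

text \<open>
  The fibre of the cylinder over \<open>x\<close> is a segment whose length is determined by the distance from
  \<open>x\<close> to the basepoint. Hence a set is bounded as soon as its projection is, and properness of a
  map out of the cylinder can be tested on the base.
\<close>

lemma bounded_in_coarse_cylinder:
  assumes x0: "x0 \<in> mspace X" and S: "S \<subseteq> mspace (coarse_cylinder X x0)"
    and bdd: "bounded_in X (fst ` S)"
  shows "bounded_in (coarse_cylinder X x0) S"
proof -
  interpret Metric_space "mspace X" "mdist X" by (rule Metric_space_mspace_mdist)
  obtain C where C: "\<And>p. p \<in> S \<Longrightarrow> mdist X (fst p) x0 \<le> C"
    using mbounded_insert[THEN iffD2, OF conjI[OF x0 bdd]] unfolding bounded_in_iff by blast
  have "mdist (coarse_cylinder X x0) p q \<le> 2 * C" if pq: "p \<in> S" "q \<in> S" for p q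
  proof -
    obtain x s t x' s' t' where [simp]: "p = (x, s, t)" "q = (x', s', t')"
      by (metis prod_cases3)
    have p: "x \<in> mspace X" "s \<ge> 0" "t \<ge> 0" "mdist X x x0 = s + t" "mdist X x x0 \<le> C"
      and q: "x' \<in> mspace X" "s' \<ge> 0" "t' \<ge> 0" "mdist X x' x0 = s' + t'" "mdist X x' x0 \<le> C"
      using pq S C[of p] C[of q] by (auto simp: mspace_coarse_cylinder)
    have "mdist X x x' \<le> mdist X x x0 + mdist X x' x0"
      using triangle[OF p(1) x0 q(1)] commute[of x' x0] by simp
    moreover have "\<bar>s - s'\<bar> + \<bar>t - t'\<bar> \<le> 2 * C"
      using p q by linarith
    ultimately show ?thesis
      using p(5) q(5) by simp
  qed
  then show ?thesis
    unfolding bounded_in_iff using S by blast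
qed

lemma coarse_map_cylinder_projection:
  assumes x0: "x0 \<in> mspace X"
  shows "coarse_map (coarse_cylinder X x0) X fst" (is "coarse_map ?C X fst")
proof (rule coarse_mapI)
  show "fst p \<in> mspace X" if "p \<in> mspace ?C" for p
    using that by (auto simp: mspace_coarse_cylinder)
next
  fix R
  show "\<exists>S. \<forall>p\<in>mspace ?C. \<forall>q\<in>mspace ?C. mdist ?C p q \<le> R \<longrightarrow> mdist X (fst p) (fst q) \<le> S"
    by (rule exI[of _ R]) auto
next
  fix B assume B: "bounded_in X B"
  show "bounded_in ?C (fst -` B \<inter> mspace ?C)"
    by (rule bounded_in_coarse_cylinder[OF x0]) (auto intro: bounded_in_subset[OF B])
qed

lemma coarsely_homotopic_refl:
  assumes f: "coarse_map X Y f"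
  shows "coarsely_homotopic X Y f f"
proof -
  have "close_maps X Y ((f \<circ> fst) \<circ> c X x0) f" if "\<And>x. fst (c X x0 x) = x"
    for x0 and c :: "'a metric \<Rightarrow> 'a \<Rightarrow> 'a \<Rightarrow> 'a \<times> real \<times> real"
    unfolding close_maps_def using that coarse_map_in[OF f]
    by (intro bdd_aboveI[of _ 0]) (auto simp: mdist_self)
  then show ?thesis
    unfolding coarsely_homotopic_def
    using f coarse_map_compose[OF coarse_map_cylinder_projection f]
    by (metis cyl_incl0_def cyl_incl1_def fst_conv)
qed

text \<open>
  The \<open>t\<close>-coordinate of the cylinder cuts the time \<open>i\<close> into a part that has been spent and a part
  \<open>m\<close> that is kept. Nothing is lost on the large scale: \<open>i\<close> is recovered as the sum, and the point
  \<open>(x, i)\<close> bounds \<open>s\<close> and \<open>t\<close>.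
\<close>

definition split_time :: "('a \<times> nat) \<times> real \<times> real \<Rightarrow> ('a \<times> nat) \<times> nat" where
  "split_time = (\<lambda>((x, i), s, t). let m = min i (nat \<lfloor>t\<rfloor>) in ((x, i - m), m))"

lemma min_nat_floor_diff_le:
  assumes "t \<ge> 0" "t' \<ge> (0::real)" "\<bar>real i - real i'\<bar> \<le> R" "\<bar>t - t'\<bar> \<le> R"
  shows "\<bar>real (min i (nat \<lfloor>t\<rfloor>)) - real (min i' (nat \<lfloor>t'\<rfloor>))\<bar> \<le> R + 1"
proof -
  obtain n n' where n: "nat \<lfloor>t\<rfloor> = n" "nat \<lfloor>t'\<rfloor> = n'"
    by blast
  have "real n \<le> t" "t < real n + 1" "real n' \<le> t'" "t' < real n' + 1"
    using assms n by linarith+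
  then show ?thesis
    using assms(3,4) unfolding n by (auto simp: min_def)
qed

lemma coarse_map_split_time:
  fixes X :: "'a metric"
  defines "XN \<equiv> max_prod_metric X nat_metric"
  assumes p0: "p0 \<in> mspace XN"
  shows "coarse_map (coarse_cylinder XN p0) (max_prod_metric XN nat_metric) split_time"
proof (rule coarse_mapI)
  show "split_time p \<in> mspace (max_prod_metric XN nat_metric)"
    if "p \<in> mspace (coarse_cylinder XN p0)" for p
    using that by (auto simp: split_time_def XN_def mspace_coarse_cylinder Let_def)
next
  fix R
  show "\<exists>S. \<forall>p\<in>mspace (coarse_cylinder XN p0). \<forall>q\<in>mspace (coarse_cylinder XN p0).
      mdist (coarse_cylinder XN p0) p q \<le> R \<longrightarrow>
      mdist (max_prod_metric XN nat_metric) (split_time p) (split_time q) \<le> S"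
    \<comment> \<open>Rounding costs \<open>1\<close> in \<open>m\<close>, and \<open>i - m\<close> adds the change of \<open>i\<close> to that of \<open>m\<close>.\<close>
  proof (intro exI[of _ "2 * R + 1"] ballI impI)
    fix p q
    assume p: "p \<in> mspace (coarse_cylinder XN p0)" and q: "q \<in> mspace (coarse_cylinder XN p0)"
      and R: "mdist (coarse_cylinder XN p0) p q \<le> R"
    obtain x i s t x' i' s' t' where pq: "p = ((x, i), s, t)" "q = ((x', i'), s', t')"
      by (metis prod.exhaust)
    have le: "mdist X x x' \<le> R" "\<bar>real i - real i'\<bar> \<le> R" "\<bar>t - t'\<bar> \<le> R"
      using R by (auto simp: XN_def pq)
    define m m' where "m = min i (nat \<lfloor>t\<rfloor>)" and "m' = min i' (nat \<lfloor>t'\<rfloor>)"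
    have "\<bar>real m - real m'\<bar> \<le> R + 1"
      unfolding m_def m'_def
      by (rule min_nat_floor_diff_le) (use p q le in \<open>simp_all add: mspace_coarse_cylinder pq\<close>)
    moreover have "real (i - m) = real i - real m" "real (i' - m') = real i' - real m'"
      by (simp_all add: m_def m'_def of_nat_diff)
    ultimately have "\<bar>real (i - m) - real (i' - m')\<bar> \<le> 2 * R + 1" "\<bar>real m - real m'\<bar> \<le> 2 * R + 1"
        "mdist X x x' \<le> 2 * R + 1"
      using le by linarith+
    moreover have "split_time p = ((x, i - m), m)" "split_time q = ((x', i' - m'), m')"
      by (simp_all add: split_time_def pq m_def m'_def Let_def)
    ultimately show "mdist (max_prod_metric XN nat_metric) (split_time p) (split_time q) \<le> 2 * R + 1"
      by (simp add: XN_def)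
  qed
next
  fix B assume B: "bounded_in (max_prod_metric XN nat_metric) B"
  let ?S = "split_time -` B \<inter> mspace (coarse_cylinder XN p0)"
  obtain C where C: "\<And>p q. p \<in> B \<Longrightarrow> q \<in> B \<Longrightarrow> mdist (max_prod_metric XN nat_metric) p q \<le> C"
    using B unfolding bounded_in_iff by blast
  have "mdist XN (fst p) (fst q) \<le> 2 * C" if "p \<in> ?S" "q \<in> ?S" for p q
  proof -
    obtain x i s t x' i' s' t' where pq: "p = ((x, i), s, t)" "q = ((x', i'), s', t')"
      by (metis prod.exhaust)
    define m m' where "m = min i (nat \<lfloor>t\<rfloor>)" and "m' = min i' (nat \<lfloor>t'\<rfloor>)"
    have "split_time p = ((x, i - m), m)" "split_time q = ((x', i' - m'), m')"
      by (simp_all add: split_time_def pq m_def m'_def Let_def)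
    then have "mdist X x x' \<le> C" "\<bar>real (i - m) - real (i' - m')\<bar> \<le> C" "\<bar>real m - real m'\<bar> \<le> C"
      using C[of "split_time p" "split_time q"] that by (simp_all add: XN_def)
    moreover have "real (i - m) = real i - real m" "real (i' - m') = real i' - real m'"
      by (simp_all add: m_def m'_def of_nat_diff)
    ultimately have "\<bar>real i - real i'\<bar> \<le> 2 * C" "mdist X x x' \<le> 2 * C"
      by linarith+
    then show ?thesis
      by (simp add: XN_def pq)
  qed
  moreover have "fst ` ?S \<subseteq> mspace XN"
    by (auto simp: mspace_coarse_cylinder)
  ultimately have "bounded_in XN (fst ` ?S)"
    unfolding bounded_in_iff by blast
  then show "bounded_in (coarse_cylinder XN p0) ?S"
    by (rule bounded_in_coarse_cylinder[OF p0 Int_lower2])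
qed

section \<open>Iterating a flasqueness witness\<close>

lemma mdist_funpow_diff_le:
  assumes \<phi>: "\<phi> \<in> mspace X \<rightarrow> mspace X"
    and D: "\<And>x. x \<in> mspace X \<Longrightarrow> mdist X (\<phi> x) x \<le> D"
    and x: "x \<in> mspace X"
  shows "mdist X ((\<phi> ^^ i) x) ((\<phi> ^^ j) x) \<le> \<bar>real i - real j\<bar> * D"
proof -
  interpret Metric_space "mspace X" "mdist X" by (rule Metric_space_mspace_mdist)
  have pow: "(\<phi> ^^ n) y \<in> mspace X" if "y \<in> mspace X" for n y
    using that \<phi> by (induction n) auto
  have step: "mdist X ((\<phi> ^^ k) y) y \<le> real k * D" if y: "y \<in> mspace X" for k y
  proof (induction k)
    case (Suc k)
    have "mdist X ((\<phi> ^^ Suc k) y) y \<le>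
        mdist X (\<phi> ((\<phi> ^^ k) y)) ((\<phi> ^^ k) y) + mdist X ((\<phi> ^^ k) y) y"
      using triangle pow[OF y] y pow[OF y, of "Suc k"] by simp
    also have "\<dots> \<le> D + real k * D"
      using D[OF pow[OF y]] Suc by (rule add_mono)
    finally show ?case
      by (simp add: algebra_simps)
  qed (use y in simp)
  have ordered: "mdist X ((\<phi> ^^ i) x) ((\<phi> ^^ j) x) \<le> \<bar>real i - real j\<bar> * D" if "j \<le> i" for i j
    using step[OF pow[OF x], of "i - j" j] that
    by (simp flip: comp_apply[of "\<phi> ^^ (i - j)"] funpow_add add: of_nat_diff)
  show ?thesis
    using ordered[of j i] ordered[of i j] by (cases "j \<le> i") (auto simp: commute abs_minus_commute)
qed

text \<open>
  Control compares \<open>\<phi>\<^sup>i x\<close> with \<open>\<phi>\<^sup>j y\<close> through \<open>\<phi>\<^sup>i y\<close>: the first step costs a constant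
  independent of \<open>i\<close> by uniform control of the powers, the second one at most \<open>\<bar>i - j\<bar>\<close> times the
  displacement of \<open>\<phi>\<close>. Properness of each single power would not be enough for properness of the
  whole family; it is the escape condition that bounds the exponents.
\<close>

lemma coarse_map_iteration:
  assumes "flasque_witness X \<phi>"
  shows "coarse_map (max_prod_metric X nat_metric) X (\<lambda>(x, i). (\<phi> ^^ i) x)"
    (is "coarse_map ?XN X ?\<Phi>")
proof -
  interpret Metric_space "mspace X" "mdist X" by (rule Metric_space_mspace_mdist)
  have \<phi>: "coarse_map X X \<phi>"
    and escape: "\<And>B. bounded_in X B \<Longrightarrow> \<exists>N. \<forall>n>N. (\<phi> ^^ n) ` mspace X \<inter> B = {}"
    and uniform: "\<And>E. entourage X E \<Longrightarrow> entourage X (\<Union>n. map_prod (\<phi> ^^ n) (\<phi> ^^ n) ` E)"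
    using assms by (auto simp: flasque_witness_def)
  have pow: "(\<phi> ^^ n) x \<in> mspace X" if "x \<in> mspace X" for n x
    using coarse_map_in[OF coarse_map_funpow[OF \<phi>]] that .
  obtain D where D: "\<And>x. x \<in> mspace X \<Longrightarrow> mdist X (\<phi> x) x \<le> D"
    using assms by (auto simp: flasque_witness_def close_maps_def bdd_above_def)
  show ?thesis
  proof (rule coarse_mapI)
    show "?\<Phi> p \<in> mspace X" if "p \<in> mspace ?XN" for p
      using that pow by auto
  next
    fix R
    have "entourage X {(x, y) \<in> mspace X \<times> mspace X. mdist X x y \<le> R}"
      by (auto simp: entourage_iff)
    then obtain C where
      C: "\<forall>(x, y) \<in> (\<Union>n. map_prod (\<phi> ^^ n) (\<phi> ^^ n) `
            {(x, y) \<in> mspace X \<times> mspace X. mdist X x y \<le> R}). mdist X x y \<le> C"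
      using uniform unfolding entourage_iff by meson
    have "mdist X ((\<phi> ^^ i) x) ((\<phi> ^^ j) y) \<le> C + R * D"
      if "x \<in> mspace X" "y \<in> mspace X" "mdist X x y \<le> R" "\<bar>real i - real j\<bar> \<le> R" for x y i j
    proof -
      have "mdist X ((\<phi> ^^ i) x) ((\<phi> ^^ i) y) \<le> C"
        using C that by fastforce
      moreover have "mdist X ((\<phi> ^^ i) y) ((\<phi> ^^ j) y) \<le> \<bar>real i - real j\<bar> * D"
        by (rule mdist_funpow_diff_le[OF _ D that(2)]) (use coarse_map_in[OF \<phi>] in auto)
      moreover have "\<bar>real i - real j\<bar> * D \<le> R * D"
        using that(4) order_trans[OF nonneg D[OF that(1)]] by (rule mult_right_mono)
      ultimately show ?thesis
        using triangle[OF pow[OF that(1), of i] pow[OF that(2), of i] pow[OF that(2), of j]]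
        by linarith
    qed
    then show "\<exists>S. \<forall>p\<in>mspace ?XN. \<forall>q\<in>mspace ?XN. mdist ?XN p q \<le> R \<longrightarrow> mdist X (?\<Phi> p) (?\<Phi> q) \<le> S"
      by (intro exI[of _ "C + R * D"]) auto
  next
    fix B assume B: "bounded_in X B"
    obtain N where N: "\<forall>n>N. (\<phi> ^^ n) ` mspace X \<inter> B = {}"
      using escape[OF B] by blast
    define K where "K = (\<Union>n\<le>N. (\<phi> ^^ n) -` B \<inter> mspace X)"
    have sub: "?\<Phi> -` B \<inter> mspace ?XN \<subseteq> K \<times> {..N}"
      using N unfolding K_def by (fastforce simp: not_less[symmetric])
    have K: "bounded_in X K"
      unfolding K_def
      by (rule mbounded_Union)
         (use coarse_map_proper[OF coarse_map_funpow[OF \<phi>] B] in blast)+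
    have N: "bounded_in nat_metric {..N}"
      unfolding bounded_in_iff by (auto intro!: exI[of _ "real N"])
    have "bounded_in X (fst ` (?\<Phi> -` B \<inter> mspace ?XN))"
      by (rule bounded_in_subset[OF K subset_trans[OF image_mono[OF sub]]]) auto
    moreover have "bounded_in nat_metric (snd ` (?\<Phi> -` B \<inter> mspace ?XN))"
      by (rule bounded_in_subset[OF N subset_trans[OF image_mono[OF sub]]]) auto
    ultimately show "bounded_in ?XN (?\<Phi> -` B \<inter> mspace ?XN)"
      unfolding bounded_in_max_prod_iff by simp
  qed
qed

text \<open>
  Postponing the iteration by the kept time \<open>m\<close> gives the homotopy. Its two ends are \<open>m = 0\<close>,
  where the iteration is carried out in full, and \<open>m\<close> equal to \<open>i\<close> up to a constant, where
  only boundedly many steps are carried out.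
\<close>

lemma coarsely_homotopic_iteration_id:
  fixes X :: "'a metric"
  assumes \<phi>: "flasque_witness X \<phi>"
  shows "coarsely_homotopic (max_prod_metric X nat_metric) (max_prod_metric X nat_metric)
           ((\<lambda>x. (x, 0)) \<circ> (\<lambda>(x, i). (\<phi> ^^ i) x)) id"
    (is "coarsely_homotopic ?XN ?XN (?\<beta> \<circ> ?\<Phi>) id")
proof -
  obtain D where D: "\<And>x. x \<in> mspace X \<Longrightarrow> mdist X (\<phi> x) x \<le> D"
    using \<phi> by (auto simp: flasque_witness_def close_maps_def bdd_above_def)
  have maps: "\<phi> \<in> mspace X \<rightarrow> mspace X"
    using \<phi> by (auto simp: flasque_witness_def coarse_map_def)
  have pow: "(\<phi> ^^ n) x \<in> mspace X" if "x \<in> mspace X" for n x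
    using that maps by (induction n) auto
  let ?h = "map_prod ?\<Phi> id \<circ> split_time"
  have "coarse_map (coarse_cylinder ?XN p0) ?XN ?h" if "p0 \<in> mspace ?XN" for p0
    by (rule coarse_map_compose[OF coarse_map_split_time
          coarse_map_map_prod[OF coarse_map_iteration[OF \<phi>] coarse_map_id]]) (rule that)
  moreover have "close_maps ?XN ?XN (?h \<circ> cyl_incl0 ?XN p0) (?\<beta> \<circ> ?\<Phi>)" for p0
    unfolding close_maps_def
    by (rule bdd_aboveI[of _ 0]) (auto simp: cyl_incl0_def split_time_def pow mdist_self)
  moreover have "close_maps ?XN ?XN (?h \<circ> cyl_incl1 ?XN p0) id" if "p0 \<in> mspace ?XN" for p0
  proof -
    obtain x0 i0 where [simp]: "p0 = (x0, i0)" by fastforce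
    have "mdist ?XN ((?h \<circ> cyl_incl1 ?XN p0) (x, i)) (x, i) \<le> max (real i0 * D) (real i0)"
      if x: "x \<in> mspace X" for x i
    proof -
      define t where "t = mdist ?XN (x, i) p0"
      define m where "m = min i (nat \<lfloor>t\<rfloor>)"
      \<comment> \<open>The time component alone already forces \<open>t\<close> to be at least \<open>i - i0\<close>; since this number
        is an integer, rounding \<open>t\<close> down loses nothing.\<close>
      have "real i - real i0 \<le> t"
        by (auto simp: t_def)
      then have "int i - int i0 \<le> \<lfloor>t\<rfloor>"
        by (simp add: le_floor_iff)
      then have rest: "i - m \<le> i0" and "m \<le> i"
        by (auto simp: m_def)
      have "mdist X ((\<phi> ^^ (i - m)) x) x \<le> real (i - m) * D"
        using mdist_funpow_diff_le[OF maps D x, of "i - m" 0] by simp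
      also have "\<dots> \<le> real i0 * D"
        using rest order_trans[OF mdist_nonneg D[OF x]] by (intro mult_right_mono) auto
      finally have "mdist X ((\<phi> ^^ (i - m)) x) x \<le> real i0 * D" .
      moreover have "\<bar>real m - real i\<bar> \<le> real i0"
        using rest \<open>m \<le> i\<close> by linarith
      moreover have "(?h \<circ> cyl_incl1 ?XN p0) (x, i) = ((\<phi> ^^ (i - m)) x, m)"
        by (simp add: cyl_incl1_def split_time_def Let_def t_def m_def)
      ultimately show ?thesis
        by (simp add: max.coboundedI1 max.coboundedI2)
    qed
    then show ?thesis
      unfolding close_maps_def by (intro bdd_aboveI) auto
  qed
  ultimately show ?thesis
    unfolding coarsely_homotopic_def
    using coarse_map_id coarse_map_compose[OF coarse_map_iteration[OF \<phi>] coarse_map_pair_0]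
    by blast
qed

theorem theorem28:
  fixes X :: "'a metric" and \<phi> :: "'a \<Rightarrow> 'a"
  assumes "flasque_witness X \<phi>"
  shows "coarse_homotopy_equivalence (max_prod_metric X nat_metric) X
           (\<lambda>(x, i). (\<phi> ^^ i) x)"
proof -
  have "(\<lambda>(x, i). (\<phi> ^^ i) x) \<circ> (\<lambda>x. (x, 0)) = id"
    by auto
  then show ?thesis
    unfolding coarse_homotopy_equivalence_def
    using coarse_map_iteration[OF assms] coarse_map_pair_0 coarsely_homotopic_iteration_id[OF assms]
      coarsely_homotopic_refl[OF coarse_map_id]
    by metis
qed

end
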